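(* Let $S$ be a finite nonempty set of primes, let $m=\gcd\{p-1 : p\in S\}$, and let $\mathcal{G}$ be the $S$-unit graph. Then there exists $N\in\mathbb{N}$ such that for every integer $n\ge N$ with $n\equiv 2\pmod{m}$ there exists a nondegenerate induced cycle of $\mathcal{G}$ of length $n$.
   Context: For a finite nonempty set $S$ of primes, $\mathbb{Z}_S$ is the ring of rational numbers whose denominators (in lowest terms) are not divisible by any prime outside $S$, and $\mathbb{Z}_S^*$ is its group of invertible elements, called $S$-units (an $S$-unit may be positive or negative). The $S$-unit graph $\mathcal{G}$ has vertex set $\mathbb{Q}$, and $x,y\in\mathbb{Q}$ are joined by an edge if and only if $x-y\in\mathbb{Z}_S^*$. A cycle of length $n\ge 3$ of $\mathcal{G}$, written $a_1\to a_2\to\cdots\to a_n\to a_1$, consists of distinct $a_1,\dots,a_n\in\mathbb{Q}$ such that $a_{i+1}-a_i$ ($1\le i\le n-1$) and $a_1-a_n$ are $S$-units. It is an induced cycle if, for distinct $i,j\in\{1,\dots,n\}$, $a_j-a_i$ is an $S$-unit if and only if $j\in\{i+1,i-1\}$ or $\{i,j\}=\{1,n\}$. Given a cycle, put $u_i=a_{i+1}-a_i$ for $i=1,\dots,n-1$ and $u_n=a_1-a_n$, so that $u_1+\cdots+u_n=0$. The cycle is degenerate if there exist an integer $l$ with $0<l<n$ and indices $1\le i_1<\cdots<i_l\le n$ such that $u_{i_1}+\cdots+u_{i_l}=0$; otherwise it is nondegenerate. *)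

theory Defs
  imports Complex_Main "HOL-Computational_Algebra.Primes" "HOL-Number_Theory.Cong"
begin

text \<open>\<open>quotient_of\<close> returns the fraction in lowest terms, with positive denominator.\<close>

definition S_integers :: "nat set \<Rightarrow> rat set" where
  "S_integers S = {x. \<forall>p. prime p \<and> int p dvd snd (quotient_of x) \<longrightarrow> p \<in> S}"

definition S_units :: "nat set \<Rightarrow> rat set" where
  "S_units S = {x \<in> S_integers S. \<exists>y \<in> S_integers S. x * y = 1}"

text \<open>The vertex set is the whole type \<^typ>\<open>rat\<close>; the graph is given by its edge
  relation, which is symmetric because \<open>-1\<close> is an \<open>S\<close>-unit, and irreflexive because
  \<open>0\<close> is not.\<close>

definition S_unit_graph :: "nat set \<Rightarrow> rat rel" where
  "S_unit_graph S = {(x, y). x - y \<in> S_units S}"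

text \<open>A cycle of length \<open>n\<close> is given by a function of which only the values
  \<open>a 1, \<dots>, a n\<close> matter.\<close>

definition graph_cycle :: "rat rel \<Rightarrow> nat \<Rightarrow> (nat \<Rightarrow> rat) \<Rightarrow> bool" where
  "graph_cycle G n a \<longleftrightarrow>
     3 \<le> n \<and> inj_on a {1..n} \<and>
     (\<forall>i\<in>{1..n - 1}. (a (i + 1), a i) \<in> G) \<and> (a 1, a n) \<in> G"

definition induced_cycle :: "rat rel \<Rightarrow> nat \<Rightarrow> (nat \<Rightarrow> rat) \<Rightarrow> bool" where
  "induced_cycle G n a \<longleftrightarrow>
     graph_cycle G n a \<and>
     (\<forall>i\<in>{1..n}. \<forall>j\<in>{1..n}. i \<noteq> j \<longrightarrow>
        ((a j, a i) \<in> G \<longleftrightarrow> j = i + 1 \<or> i = j + 1 \<or> {i, j} = {1, n}))"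

definition cycle_step :: "nat \<Rightarrow> (nat \<Rightarrow> rat) \<Rightarrow> nat \<Rightarrow> rat" where
  "cycle_step n a i = (if i = n then a 1 - a n else a (i + 1) - a i)"

text \<open>The set \<open>I\<close> consists of the indices \<open>i\<^sub>1 < \<dots> < i\<^sub>l\<close>.\<close>

definition degenerate_cycle :: "nat \<Rightarrow> (nat \<Rightarrow> rat) \<Rightarrow> bool" where
  "degenerate_cycle n a \<longleftrightarrow>
     (\<exists>l I. 0 < l \<and> l < n \<and> I \<subseteq> {1..n} \<and> card I = l \<and> (\<Sum>i\<in>I. cycle_step n a i) = 0)"

end

theory Submission
  imports Defs
begin

text \<open>If all steps of a closed walk but the last are positive, no proper subset of the steps sums
  to zero; so it suffices to find an increasing sequence of integers in which the difference of two
  terms is \<open>S\<close>-smooth exactly for neighbours and for the two extremes. Let \<open>P\<close> be the product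
  of \<open>S\<close>. The basic list of steps is \<open>1, P, \<dots>, P ^ (k - 1)\<close>, repeated \<open>P - 1\<close> times and followed
  by a final \<open>1\<close>; it has sum \<open>P ^ k\<close>. Up to the factor \<open>P - 1\<close>, a block sum is
  \<open>d * P ^ k + (P ^ j' - P ^ j - d)\<close> with \<open>d < P\<close>. Apart from a few degenerate cases, its
  \<open>S\<close>-part is bounded independently of \<open>k\<close>, so the block is too large to be smooth.

  To correct the length modulo \<open>P - 1\<close>, split off further smooth steps divisible by \<open>P ^ k\<close>:
  passing from a total \<open>w\<close> to \<open>p * w\<close> takes \<open>p - 1\<close> steps \<open>w\<close>, and these lengths generate the
  multiples of \<open>m\<close> modulo \<open>P - 1\<close>. Placed between basic steps they do no harm, because the
  sum of a proper basic block is not divisible by \<open>p ^ k\<close> for any \<open>p\<close> in \<open>S\<close>.\<close>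

section \<open>Smooth numbers and integral \<open>S\<close>-units\<close>

definition smooth :: "nat set \<Rightarrow> nat \<Rightarrow> bool" where
  "smooth S x \<longleftrightarrow> x > 0 \<and> (\<forall>p. prime p \<longrightarrow> p dvd x \<longrightarrow> p \<in> S)"

lemma smooth_1 [simp]: "smooth S (Suc 0)"
  by (auto simp: smooth_def)

lemma smooth_mult: "smooth S x \<Longrightarrow> smooth S y \<Longrightarrow> smooth S (x * y)"
  by (auto simp: smooth_def prime_dvd_mult_iff)

lemma smooth_power: "smooth S x \<Longrightarrow> smooth S (x ^ e)"
  by (induction e) (auto intro: smooth_mult)

lemma smooth_dvd: "smooth S x \<Longrightarrow> y dvd x \<Longrightarrow> smooth S y"
  by (auto simp: smooth_def intro: dvd_trans gr0I)

lemma smooth_prime: "prime p \<Longrightarrow> p \<in> S \<Longrightarrow> smooth S p"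
  by (auto simp: smooth_def prime_gt_0_nat dest: primes_dvd_imp_eq)

lemma smooth_prod:
  assumes "\<forall>p\<in>A. prime p" "A \<subseteq> S"
  shows "smooth S (\<Prod>A)"
  using assms by (induction A rule: infinite_finite_induct) (auto intro!: smooth_mult intro: smooth_prime)

lemma S_units_of_nat_iff: "of_nat x \<in> S_units S \<longleftrightarrow> smooth S x"
proof (cases "x = 0")
  case True
  then show ?thesis by (auto simp: S_units_def smooth_def)
next
  case False
  have q: "quotient_of (of_nat x) = (int x, 1)"
    by (metis of_int_of_nat_eq quotient_of_int Rat.of_int_def)
  have i: "snd (quotient_of (inverse (of_nat x))) = int x"
    using False by (simp add: rat_inverse_code q)
  have "of_nat x \<in> S_units S \<longleftrightarrow> inverse (of_nat x :: rat) \<in> S_integers S"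
  proof
    assume "of_nat x \<in> S_units S"
    then obtain y where "y \<in> S_integers S" "(of_nat x :: rat) * y = 1"
      by (auto simp: S_units_def)
    then show "inverse (of_nat x :: rat) \<in> S_integers S"
      by (metis inverse_unique)
  next
    assume "inverse (of_nat x :: rat) \<in> S_integers S"
    moreover have "(of_nat x :: rat) \<in> S_integers S"
      by (auto simp: S_integers_def q)
    ultimately show "of_nat x \<in> S_units S"
      using False by (auto simp: S_units_def intro!: bexI[of _ "inverse (of_nat x)"])
  qed
  then show ?thesis
    using False by (auto simp: S_integers_def i smooth_def)
qed

lemma S_units_minus_iff: "- x \<in> S_units S \<longleftrightarrow> x \<in> S_units S"
proof -
  have i: "- x \<in> S_integers S" if "x \<in> S_integers S" for x
    using that by (auto simp: S_integers_def rat_uminus_code split: prod.splits)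
  have "- x \<in> S_units S" if "x \<in> S_units S" for x
    using that i by (force simp: S_units_def)
  from this[of x] this[of "- x"] show ?thesis by auto
qed

lemma smooth_dvd_if_prime_powers:
  assumes "smooth S x" "\<And>p e. p \<in> S \<Longrightarrow> prime p \<Longrightarrow> p ^ e dvd x \<Longrightarrow> p ^ e dvd y" "y > 0"
  shows "x dvd y"
proof (rule multiplicity_le_imp_dvd)
  show "x \<noteq> 0" using assms by (auto simp: smooth_def)
  show "multiplicity p x \<le> multiplicity p y" if p: "prime p" for p
  proof (cases "p dvd x")
    case True
    then have "p ^ multiplicity p x dvd y"
      using assms p by (auto simp: smooth_def multiplicity_dvd)
    then show ?thesis
      using assms(3) p by (intro multiplicity_geI) auto
  qed (simp add: not_dvd_imp_multiplicity_0)
qed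

text \<open>At each prime of \<open>S\<close>, \<open>A\<close> has valuation below \<open>k\<close>
  and \<open>Y\<close> at least \<open>k\<close>, so \<open>A + Y\<close> has the valuation of
  \<open>A\<close>. If smooth, \<open>A + Y\<close> would divide the smaller number
  \<open>A\<close>.\<close>

lemma not_smooth_add:
  assumes A: "\<And>p. p \<in> S \<Longrightarrow> prime p \<Longrightarrow> \<not> p ^ k dvd A"
    and Y: "\<And>p. p \<in> S \<Longrightarrow> prime p \<Longrightarrow> p ^ k dvd Y" and "A > 0" "Y > 0"
  shows "\<not> smooth S (A + Y)"
proof
  assume s: "smooth S (A + Y)"
  have "A + Y dvd A"
  proof (rule smooth_dvd_if_prime_powers[OF s _ \<open>A > 0\<close>])
    fix p e assume p: "p \<in> S" "prime p" "p ^ e dvd A + Y"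
    have "e < k"
    proof (rule ccontr)
      assume "\<not> e < k"
      then have "p ^ k dvd A + Y" using p(3) by (meson dvd_trans le_imp_power_dvd not_less)
      then show False using A[OF p(1,2)] Y[OF p(1,2)] by (simp add: dvd_add_left_iff)
    qed
    then have "p ^ e dvd Y"
      using Y[OF p(1,2)] by (meson dvd_trans le_imp_power_dvd less_imp_le)
    then show "p ^ e dvd A" using p(3) by (simp add: dvd_add_left_iff)
  qed
  then show False using \<open>A > 0\<close> \<open>Y > 0\<close> by (auto dest: dvd_imp_le)
qed

section \<open>From increasing integer sequences to cycles\<close>

text \<open>The first \<open>N\<close> steps are positive and the last is minus their sum. A
  vanishing proper subsum would contain the last step, and its complement would be a nonempty set of
  positive steps with sum zero. Vertices are numbered from \<open>1\<close>, values of
  \<open>F\<close> from \<open>0\<close>.\<close>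

lemma induced_nondegenerate_cycle_of_increasing:
  fixes F :: "nat \<Rightarrow> nat"
  assumes N: "N \<ge> 2" and mono: "\<And>i j. i < j \<Longrightarrow> j \<le> N \<Longrightarrow> F i < F j"
    and edge: "\<And>i j. i < j \<Longrightarrow> j \<le> N \<Longrightarrow>
      smooth S (F j - F i) \<longleftrightarrow> j = i + 1 \<or> (i = 0 \<and> j = N)"
  defines "a \<equiv> \<lambda>i. of_nat (F (i - 1)) :: rat"
  shows "induced_cycle (S_unit_graph S) (N + 1) a \<and> \<not> degenerate_cycle (N + 1) a"
proof
  have inj: "inj_on a {1..N + 1}"
  proof (rule linorder_inj_onI)
    show "a i \<noteq> a j" if "i < j" "i \<in> {1..N + 1}" "j \<in> {1..N + 1}" for i j
    proof -
      have "i - 1 < j - 1" "j - 1 \<le> N" using that by auto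
      from mono[OF this] show ?thesis by (simp add: a_def)
    qed
  qed auto
  have up: "(a j, a i) \<in> S_unit_graph S \<longleftrightarrow> j = i + 1 \<or> (i = 1 \<and> j = N + 1)"
    if "1 \<le> i" "i < j" "j \<le> N + 1" for i j
  proof -
    have "i - 1 < j - 1" "j - 1 \<le> N" using that by auto
    from mono[OF this] have "a j - a i = of_nat (F (j - 1) - F (i - 1))"
      by (simp add: a_def of_nat_diff)
    then have "(a j, a i) \<in> S_unit_graph S \<longleftrightarrow> smooth S (F (j - 1) - F (i - 1))"
      by (simp add: S_unit_graph_def S_units_of_nat_iff)
    then show ?thesis using that edge[of "i - 1" "j - 1"] by auto
  qed
  have sym: "(x, y) \<in> S_unit_graph S \<longleftrightarrow> (y, x) \<in> S_unit_graph S" for x y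
    using S_units_minus_iff[of "x - y" S] by (simp add: S_unit_graph_def)
  show "induced_cycle (S_unit_graph S) (N + 1) a"
    unfolding induced_cycle_def graph_cycle_def
  proof (intro conjI ballI impI)
    show "(a 1, a (N + 1)) \<in> S_unit_graph S"
      using up[of 1 "N + 1"] N sym by auto
    fix i j assume ij: "i \<in> {1..N + 1}" "j \<in> {1..N + 1}" "i \<noteq> j"
    then consider "i < j" | "j < i" by linarith
    then show "(a j, a i) \<in> S_unit_graph S \<longleftrightarrow> j = i + 1 \<or> i = j + 1 \<or> {i, j} = {1, N + 1}"
    proof cases
      case 1
      then show ?thesis using up[of i j] ij by (auto simp: doubleton_eq_iff)
    next
      case 2
      then show ?thesis using up[of j i] ij sym by (auto simp: doubleton_eq_iff)
    qed
  qed (use N inj up in auto)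
  define u where "u = cycle_step (N + 1) a"
  have pos: "u i > 0" if "i \<in> {1..N}" for i
    using that mono[of "i - 1" i] by (auto simp: u_def cycle_step_def a_def)
  have total: "sum u {1..N + 1} = 0"
  proof -
    have "(\<Sum>i=1..N. u i) = (\<Sum>i=1..<Suc N. a (Suc i) - a i)"
      by (rule sum.cong) (auto simp: u_def cycle_step_def)
    also have "\<dots> = a (N + 1) - a 1"
      by (subst sum_Suc_diff') auto
    finally show ?thesis by (simp add: u_def cycle_step_def)
  qed
  have ne0: "sum u I \<noteq> 0" if "I \<subseteq> {1..N}" "I \<noteq> {}" for I
  proof -
    have "finite I" using that finite_subset by blast
    then have "sum u I > 0" using that pos by (intro sum_pos) auto
    then show ?thesis by simp
  qed
  show "\<not> degenerate_cycle (N + 1) a"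
  proof
    assume "degenerate_cycle (N + 1) a"
    then obtain I where I: "0 < card I" "card I < N + 1" "I \<subseteq> {1..N + 1}" "sum u I = 0"
      by (auto simp: degenerate_cycle_def u_def)
    show False
    proof (cases "N + 1 \<in> I")
      case False
      then have "I \<subseteq> {1..N}" using I(3) by (force simp: le_Suc_eq)
      moreover have "I \<noteq> {}" using I(1) by auto
      ultimately show False using ne0 I(4) by blast
    next
      case True
      define J where "J = {1..N + 1} - I"
      have "sum u J = 0"
        unfolding J_def using I total by (subst sum_diff) auto
      moreover have "J \<subseteq> {1..N}" using True by (force simp: J_def le_Suc_eq)
      moreover have "J \<noteq> {}" using I by (auto simp: J_def dest!: card_mono[rotated])
      ultimately show False using ne0 by blast
    qed
  qed
qed

section \<open>Valuation bounds independent of the exponents\<close>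

text \<open>From \<open>P \<le> 2 ^ P\<close> follows
  \<open>P ^ a \<le> 2 ^ (a * P) \<le> p ^ (a * P)\<close>, too large for a divisor of
  \<open>x\<close>.\<close>

lemma power_not_dvd_small:
  fixes p x :: int and P a :: nat
  assumes "p \<ge> 2" "x \<noteq> 0" "\<bar>x\<bar> < int P ^ a"
  shows "\<not> p ^ (a * P) dvd x"
proof
  assume "p ^ (a * P) dvd x"
  then have "p ^ (a * P) \<le> \<bar>x\<bar>"
    using assms by (metis dvd_abs_iff zdvd_imp_le zero_less_abs_iff)
  moreover have "int P \<le> 2 ^ P"
    by (metis less_exp less_imp_le of_nat_le_iff of_nat_numeral of_nat_power)
  then have "int P ^ a \<le> (2 ^ P) ^ a" by (rule power_mono) simp
  moreover have "((2::int) ^ P) ^ a = 2 ^ (a * P)" by (simp add: power_mult mult.commute)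
  moreover have "(2::int) ^ (a * P) \<le> p ^ (a * P)"
    using assms by (intro power_mono) auto
  ultimately show False using assms by linarith
qed

text \<open>The exponent \<open>P ^ 3\<close> does not depend on \<open>i\<close> and \<open>j\<close>: a power \<open>P ^ i\<close> with \<open>i\<close> large
  does not affect the valuation at \<open>p\<close>, and dropping it leaves a bounded nonzero integer.\<close>

lemma power_not_dvd_power_diff:
  fixes p :: int and P d i j :: nat
  assumes p: "p \<ge> 2" "p dvd int P" and d: "1 \<le> d" "d < P"
    and ne: "int P ^ i - int P ^ j - int d \<noteq> 0" and exc: "\<not> (i = 0 \<and> d = 1)"
  shows "\<not> p ^ (P ^ 3) dvd int P ^ i - int P ^ j - int d"
proof
  let ?z = "int P ^ i - int P ^ j - int d"
  assume z: "p ^ (P ^ 3) dvd ?z"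
  have P: "P \<ge> 2" using d by auto
  have pd: "p ^ e dvd ?z" if "e \<le> P ^ 3" for e
    using z that by (meson dvd_trans le_imp_power_dvd)
  have pP: "p ^ e dvd int P ^ i" if "e \<le> i" for e i
    using that p by (meson dvd_trans dvd_power_same le_imp_power_dvd)
  have le: "P \<le> P ^ 3" "P * P \<le> P ^ 3" "P \<le> P * P"
    using P by (auto simp: power3_eq_cube)
  have pow: "int P ^ i + int P \<le> int P ^ e" if "i < e" "2 \<le> e" for i e
  proof (cases "i = 0")
    case True
    have "1 + int P \<le> int P ^ 2" using P by (auto simp: power2_eq_square intro: order_trans[of _ "2 * int P"])
    also have "\<dots> \<le> int P ^ e" using that P by (intro power_increasing) auto
    finally show ?thesis using True by simp
  next
    case False
    then have "int P ^ 1 \<le> int P ^ i" using P by (intro power_increasing) auto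
    then have "int P ^ i + int P \<le> 2 * int P ^ i" by simp
    also have "\<dots> \<le> int P * int P ^ i" using P by (intro mult_right_mono) auto
    also have "\<dots> = int P ^ Suc i" by simp
    also have "\<dots> \<le> int P ^ e" using that P by (intro power_increasing) auto
    finally show ?thesis .
  qed
  have small: "\<bar>int P ^ i - int d\<bar> < int P ^ e" "\<bar>int P ^ i + int d\<bar> < int P ^ e"
    if "i < e" "2 \<le> e" for i e
    using pow[OF that] d zero_le_power[of "int P" i] unfolding abs_less_iff by linarith+
  \<comment> \<open>If both exponents reach \<open>P\<close>, then \<open>p ^ P\<close> divides
    \<open>d < P\<close>. If one reaches \<open>P * P\<close> and the other stays below
    \<open>P\<close>, dropping the large power leaves a number of size below \<open>P ^ P\<close>.
    Otherwise the whole expression has size below \<open>P ^ (P * P)\<close>.\<close>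
  consider "i \<ge> P" "j \<ge> P" | "i < P" "j \<ge> P * P" | "j < P" "i \<ge> P * P"
    | "i < P * P" "j < P * P"
    using le by linarith
  then show False
  proof cases
    case 1
    then have "p ^ P dvd (int P ^ i - int P ^ j) - ?z"
      using dvd_diff[OF dvd_diff[OF pP pP] pd] le 1 by blast
    then have "p ^ (1 * P) dvd int d" by simp
    then show False using power_not_dvd_small[of p "int d" P 1] p d by auto
  next
    case 2
    have "p ^ (P * P) dvd ?z + int P ^ j"
      using dvd_add[OF pd pP] le 2 by blast
    then have "p ^ (P * P) dvd int P ^ i - int d" by simp
    moreover have "int P ^ i - int d \<noteq> 0"
    proof (cases i)
      case (Suc i')
      have "int P ^ 1 \<le> int P ^ i" using P Suc by (intro power_increasing) auto
      then show ?thesis using d by auto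
    qed (use exc in auto)
    ultimately show False
      using power_not_dvd_small[of p "int P ^ i - int d" P P] p small[of i P] 2 P by auto
  next
    case 3
    have "p ^ (P * P) dvd int P ^ i - ?z"
      using dvd_diff[OF pP pd] le 3 by blast
    then have "p ^ (P * P) dvd int P ^ j + int d" by simp
    moreover have "int P ^ j + int d \<noteq> 0" using d zero_le_power[of "int P" j] by linarith
    ultimately show False
      using power_not_dvd_small[of p "int P ^ j + int d" P P] p small[of j P] 3 P by auto
  next
    case 4
    have "2 \<le> P * P" using P le by linarith
    then have "\<bar>?z\<bar> < int P ^ (P * P)"
      using pow[of i "P * P"] pow[of j "P * P"] 4 d
        zero_le_power[of "int P" i] zero_le_power[of "int P" j]
      unfolding abs_less_iff by linarith
    then show False
      using power_not_dvd_small[of p ?z P "P * P"] p ne pd[of "P * P * P"]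
      by (auto simp: power3_eq_cube)
  qed
qed


section \<open>Block sums of the basic list\<close>

lemma prime_power_dvd_prod_power:
  fixes S :: "nat set"
  assumes "finite S" "\<forall>p\<in>S. prime p" "p \<in> S" "p ^ k dvd (\<Prod>S) ^ j"
  shows "k \<le> j"
proof -
  let ?c = "\<Prod>(S - {p})"
  have "\<not> p dvd ?c"
  proof
    assume "p dvd ?c"
    then obtain r where "r \<in> S - {p}" "p dvd r"
      using assms by (auto simp: prime_dvd_prod_iff)
    then show False using assms primes_dvd_imp_eq[of p r] by auto
  qed
  then have "coprime (p ^ k) (?c ^ j)"
    using assms prime_imp_coprime[of p ?c] by (simp add: coprime_power_left_iff coprime_power_right_iff)
  moreover have "\<Prod>S = p * ?c" using assms by (simp add: prod.remove)
  ultimately have "p ^ k dvd p ^ j"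
    using assms(4) by (simp add: power_mult_distrib coprime_dvd_mult_left_iff)
  then show ?thesis
    using assms prime_gt_1_nat[of p] power_dvd_imp_le by blast
qed

text \<open>\<open>A\<close> is \<open>P ^ j\<close> times the repunit
  \<open>1 + P + ... + P ^ (a - 1)\<close>, which is \<open>1\<close> modulo every prime of
  \<open>S\<close>. So \<open>A\<close> has the valuations of \<open>P ^ j\<close> at these primes
  and is smooth only if the repunit is \<open>1\<close>.\<close>

lemma power_times_repunit:
  assumes S: "finite S" "\<forall>p\<in>S. prime p" and P: "P = \<Prod>S" "P \<ge> 2" and "a \<ge> 1" "j < k"
    and A: "int A * (int P - 1) = int P ^ j * (int P ^ a - 1)"
  shows "\<forall>p\<in>S. \<not> p ^ k dvd A" "smooth S A \<Longrightarrow> a = 1"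
proof -
  define r where "r = (\<Sum>i<a. P ^ i)"
  have "int A * (int P - 1) = int (P ^ j * r) * (int P - 1)"
    using A by (simp add: r_def power_diff_1_eq algebra_simps)
  then have Ar: "A = P ^ j * r" using P(2) by (simp only: mult_cancel_right of_nat_eq_iff) auto
  obtain b where b: "a = Suc b" using \<open>a \<ge> 1\<close> by (cases a) auto
  have r: "r = 1 + P * (\<Sum>i<b. P ^ i)"
    unfolding r_def b sum.lessThan_Suc_shift by (simp add: sum_distrib_left)
  have ndvd: "\<not> p dvd r" if "p \<in> S" for p
  proof -
    have "p dvd P" using S P that by (auto intro: dvd_prodI)
    then have "p dvd P * (\<Sum>i<b. P ^ i)" by simp
    moreover have "\<not> p dvd 1" using S that by (auto simp: not_prime_unit)
    ultimately show ?thesis unfolding r using dvd_add_left_iff by blast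
  qed
  show "\<forall>p\<in>S. \<not> p ^ k dvd A"
  proof (intro ballI notI)
    fix p assume p: "p \<in> S" "p ^ k dvd A"
    have "coprime (p ^ k) r"
      using S p ndvd prime_imp_coprime[of p r] by (simp add: coprime_power_left_iff)
    then have "p ^ k dvd P ^ j" using p by (simp add: Ar coprime_dvd_mult_left_iff)
    then show False
      using prime_power_dvd_prod_power[OF S p(1), of k j] \<open>j < k\<close> unfolding P(1) by simp
  qed
  show "a = 1" if "smooth S A"
  proof (rule ccontr)
    assume "a \<noteq> 1"
    then have "b \<noteq> 0" using b by auto
    then have "r \<noteq> 1" using P(2) by (auto simp: r lessThan_Suc neq0_conv gr0_conv_Suc sum.lessThan_Suc_shift)
    then obtain p where "prime p" "p dvd r" using prime_factor_nat by blast
    moreover have "smooth S r" using that by (rule smooth_dvd) (simp add: Ar)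
    ultimately show False using ndvd by (auto simp: smooth_def)
  qed
qed

lemma sum_power_mod:
  assumes "k > 0"
  shows "int (\<Sum>r<q. P ^ (r mod k)) * (int P - 1) =
    int (q div k) * (int P ^ k - 1) + int P ^ (q mod k) - 1"
proof (induction q)
  case (Suc q)
  show ?case
  proof (cases "Suc (q mod k) = k")
    case True
    then have "int P ^ k = int P * int P ^ (q mod k)" by (metis power_Suc)
    then show ?thesis using Suc True by (simp add: div_Suc mod_Suc algebra_simps)
  next
    case False
    then show ?thesis using Suc by (simp add: div_Suc mod_Suc algebra_simps)
  qed
qed auto

text \<open>\<open>A\<close> sums the basic steps numbered \<open>q\<close> to
  \<open>q' - 1\<close>. The full list is excluded because its sum is the smooth number
  \<open>P ^ k\<close>.\<close>

lemma block_of_powers: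
  fixes S :: "nat set" and P k q q' :: nat
  assumes S: "finite S" "\<forall>p\<in>S. prime p" and P: "P = \<Prod>S" "P \<ge> 2" and k: "k \<ge> P ^ 3 + 2"
    and q: "q < q'" "q' \<le> (P - 1) * k + 1" "\<not> (q = 0 \<and> q' = (P - 1) * k + 1)"
  defines "A \<equiv> (\<Sum>r<q'. P ^ (r mod k)) - (\<Sum>r<q. P ^ (r mod k))"
  shows "(\<forall>p\<in>S. \<not> p ^ k dvd A) \<and> (smooth S A \<longrightarrow> q' = q + 1)"
proof -
  define t j t' j' where tj: "t = q div k" "j = q mod k" "t' = q' div k" "j' = q' mod k"
  define d where "d = t' - t"
  have k2: "k \<ge> 2" using k by auto
  have qt: "q = t * k + j" "q' = t' * k + j'" by (simp_all add: tj)
  have j: "j < k" "j' < k" using k2 by (auto simp: tj)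
  have t: "t \<le> t'" using q by (auto simp: tj div_le_mono)
  have "t' \<le> ((P - 1) * k + 1) div k" unfolding tj by (rule div_le_mono[OF q(2)])
  moreover have "k > 1" using k2 by simp
  then have "((P - 1) * k + 1) div k = P - 1"
    using div_mult_self1[of k 1 "P - 1"] by (simp add: add.commute)
  ultimately have t': "t' \<le> P - 1" by simp
  have "(\<Sum>r<q. P ^ (r mod k)) \<le> (\<Sum>r<q'. P ^ (r mod k))"
    using q by (intro sum_mono2) auto
  then have "int A * (int P - 1) = int (t' - t) * (int P ^ k - 1) + int P ^ j' - int P ^ j"
    using sum_power_mod[of k P q] sum_power_mod[of k P q'] k2 t
    by (simp add: A_def tj of_nat_diff algebra_simps)
  then have D: "int A * (int P - 1) = int d * (int P ^ k - 1) + int P ^ j' - int P ^ j"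
    by (simp add: d_def)
  have dP: "int p dvd int P" if "p \<in> S" for p
    using S P that by (auto intro: dvd_prodI)
  \<comment> \<open>A block inside one period, ending before its last step (\<open>d = 0\<close>) or
    with it (\<open>d = 1\<close>, \<open>j' = 0\<close>), is a power of \<open>P\<close> times a
    repunit. Other blocks rely on the bounded valuation of
    \<open>P ^ j' - P ^ j - d\<close>.\<close>
  consider "d = 0" | "d = 1" "j' = 0" | "d \<ge> 1" "\<not> (j' = 0 \<and> d = 1)" by linarith
  then show ?thesis
  proof cases
    case 1
    then have "t' = t" using t by (simp add: d_def)
    then have jj: "j < j'" using q qt by auto
    have "int P ^ j' = int P ^ j * int P ^ (j' - j)" using jj by (simp flip: power_add)
    then have "int A * (int P - 1) = int P ^ j * (int P ^ (j' - j) - 1)"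
      using D 1 by (simp add: algebra_simps)
    from power_times_repunit[OF S P _ j(1) this] have
      "\<forall>p\<in>S. \<not> p ^ k dvd A" "smooth S A \<Longrightarrow> j' - j = 1" using jj by auto
    moreover have "q' = q + 1" if "j' - j = 1" using that qt \<open>t' = t\<close> by simp
    ultimately show ?thesis by blast
  next
    case 2
    have "int P ^ k = int P ^ j * int P ^ (k - j)" using j by (simp flip: power_add)
    then have "int A * (int P - 1) = int P ^ j * (int P ^ (k - j) - 1)"
      using D 2 by (simp add: algebra_simps)
    from power_times_repunit[OF S P _ j(1) this] have
      "\<forall>p\<in>S. \<not> p ^ k dvd A" "smooth S A \<Longrightarrow> k - j = 1" using j by auto
    moreover have "q' = q + 1" if "k - j = 1"
    proof -
      have "t' = t + 1" "k = j + 1" using 2 that by (auto simp: d_def)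
      then show ?thesis using qt 2 by simp
    qed
    ultimately show ?thesis by auto
  next
    case 3
    let ?z = "int P ^ j' - int P ^ j - int d"
    have "d < P" using t' P by (simp add: d_def)
    \<comment> \<open>As \<open>0 < d < P\<close>, vanishing forces \<open>j = 0\<close>,
      \<open>j' = 1\<close> and \<open>d = P - 1\<close>: the excluded full list.\<close>
    have "?z \<noteq> 0"
    proof
      assume "?z = 0"
      then have e: "P ^ j' = P ^ j + d" by (simp flip: of_nat_power of_nat_add)
      then have "P ^ j < P ^ j'" using 3 by simp
      then have "j < j'" using P by simp
      then obtain i where i: "j' = Suc (j + i)" using less_iff_Suc_add by auto
      have "P ^ j * P \<le> P ^ j'" unfolding i using P by (simp add: power_add)
      then have le: "P ^ j * (P - 1) \<le> d" using e by (simp add: diff_mult_distrib2)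
      have "j = 0"
      proof (rule ccontr)
        assume "j \<noteq> 0"
        then have "P ^ 1 \<le> P ^ j" using P by (intro power_increasing) auto
        then have "P * (P - 1) \<le> P ^ j * (P - 1)" by (intro mult_right_mono) auto
        moreover have "P * 1 \<le> P * (P - 1)" using P by (intro mult_left_mono) auto
        ultimately show False using le \<open>d < P\<close> by linarith
      qed
      then have dP1: "d = P - 1" using le[unfolded \<open>j = 0\<close>] \<open>d < P\<close> by simp
      then have "P ^ j' = P ^ 1" using e \<open>j = 0\<close> P(2) by simp
      then have "j' = 1" using P(2) power_inject_exp[of P j' 1] by auto
      moreover have "t = 0" "t' = P - 1" using dP1 t t' P(2) by (auto simp: d_def)
      ultimately show False using q(3) qt \<open>j = 0\<close> by simp
    qed
    then have z: "\<not> int p ^ (P ^ 3) dvd ?z" if "p \<in> S" for p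
    proof -
      have "int p \<ge> 2" using S(2) that prime_ge_2_nat[of p] by auto
      from power_not_dvd_power_diff[OF this dP[OF that] 3(1) \<open>d < P\<close> \<open>?z \<noteq> 0\<close> 3(2)]
      show ?thesis .
    qed
    have A: "\<not> p ^ e dvd A" if "p \<in> S" "P ^ 3 \<le> e" for p e
    proof
      assume "p ^ e dvd A"
      then have "int (p ^ (P ^ 3)) dvd int A"
        using that(2) by (meson dvd_trans le_imp_power_dvd of_nat_dvd_iff)
      then have "int p ^ (P ^ 3) dvd int A * (int P - 1)" by simp
      moreover have "int p ^ (P ^ 3) dvd int P ^ (P ^ 3)" using dP[OF that(1)] by (rule dvd_power_same)
      then have "int p ^ (P ^ 3) dvd int P ^ k"
        using k by (meson dvd_trans le_imp_power_dvd add_leD1)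
      then have "int p ^ (P ^ 3) dvd int d * int P ^ k" by simp
      ultimately have "int p ^ (P ^ 3) dvd int A * (int P - 1) - int d * int P ^ k" by (rule dvd_diff)
      then show False using z[OF that(1)] unfolding D by (simp add: algebra_simps)
    qed
    \<comment> \<open>A smooth \<open>A\<close> would divide \<open>P ^ (P ^ 3)\<close>, whereas
      \<open>d \<ge> 1\<close> gives \<open>A \<ge> P ^ (k - 1)\<close>; the bound on
      \<open>k\<close> separates the two.\<close>
    have "\<not> smooth S A"
    proof
      assume s: "smooth S A"
      have "A dvd P ^ (P ^ 3)"
      proof (rule smooth_dvd_if_prime_powers[OF s])
        fix p e assume p: "p \<in> S" "p ^ e dvd A"
        then have "e \<le> P ^ 3" using A[of p e] by linarith
        moreover have "p dvd P" using dP[OF p(1)] by simp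
        ultimately show "p ^ e dvd P ^ (P ^ 3)"
          by (meson dvd_trans dvd_power_same le_imp_power_dvd)
      qed (use P(2) in auto)
      then have "A \<le> P ^ (P ^ 3)" using P(2) by (auto dest: dvd_imp_le)
      also have "\<dots> < P ^ (k - 1)" using P(2) k by (intro power_strict_increasing) auto
      finally have "A < P ^ (k - 1)" .
      have "int P ^ k = int P * int P ^ (k - 1)" using k2 by (cases k) auto
      moreover have "int P ^ j \<le> int P ^ (k - 1)" using j P(2) by (intro power_increasing) auto
      moreover have "1 \<le> int P ^ j'" using P(2) by (intro one_le_power) auto
      moreover have "1 * (int P ^ k - 1) \<le> int d * (int P ^ k - 1)"
        using 3 P(2) by (intro mult_right_mono) (auto intro: one_le_power)
      ultimately have "int P ^ (k - 1) * (int P - 1) \<le> int A * (int P - 1)"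
        unfolding D by (simp add: algebra_simps)
      then have "int P ^ (k - 1) \<le> int A" using P(2) by (simp add: mult_le_cancel_right)
      then have "P ^ (k - 1) \<le> A" by (metis of_nat_le_iff of_nat_power)
      then show False using \<open>A < P ^ (k - 1)\<close> by simp
    qed
    then show ?thesis using A k by auto
  qed
qed

section \<open>Extra steps and their number modulo \<open>c\<close>\<close>

text \<open>The \<open>y r\<close> are the extra steps divided by \<open>P ^ k\<close>. The leading
  \<open>1\<close> stands for the basic list, of sum \<open>P ^ k\<close>; the last condition makes
  the closing edge an \<open>S\<close>-unit.\<close>

definition unit_chain :: "nat set \<Rightarrow> nat \<Rightarrow> bool" where
  "unit_chain S s \<longleftrightarrow>
     (\<exists>y. (\<forall>r<s. smooth S (y r)) \<and> smooth S (1 + (\<Sum>r<s. y r)))"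

lemma unit_chain_0: "unit_chain S 0"
  by (simp add: unit_chain_def)

lemma unit_chain_add_prime:
  assumes "unit_chain S s" "prime p" "p \<in> S"
  shows "unit_chain S (s + (p - 1))"
proof -
  obtain y where y: "\<forall>r<s. smooth S (y r)" "smooth S (1 + (\<Sum>r<s. y r))"
    using assms by (auto simp: unit_chain_def)
  define w where "w = 1 + (\<Sum>r<s. y r)"
  define y' where "y' r = (if r < s then y r else w)" for r
  have "(\<Sum>r<s + b. y' r) = (\<Sum>r<s. y r) + b * w" for b
    by (induction b) (auto simp: y'_def)
  then have "1 + (\<Sum>r<s + (p - 1). y' r) = w + (p - 1) * w" by (simp add: w_def)
  also have "\<dots> = p * w" using prime_gt_0_nat[OF assms(2)] by (cases p) auto
  finally have "smooth S (1 + (\<Sum>r<s + (p - 1). y' r))"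
    using y assms smooth_mult[of S p w] smooth_prime[of p S] by (simp add: w_def)
  moreover have "\<forall>r<s + (p - 1). smooth S (y' r)" using y by (auto simp: y'_def w_def)
  ultimately show ?thesis unfolding unit_chain_def by blast
qed

text \<open>Primes are adjoined one at a time by Bezout's identity. Since steps can only be added,
  possibly negative coefficients are replaced by their residues modulo \<open>c\<close>.\<close>

lemma unit_chain_cong:
  assumes "finite A" "A \<subseteq> S" "\<forall>p\<in>S. prime p" "c > 0"
    "unit_chain S s" "Gcd {p - 1 |p. p \<in> A} dvd x"
  shows "\<exists>s'. unit_chain S s' \<and> [s' = s + x] (mod c)"
  using assms
proof (induction A arbitrary: s x rule: finite_induct)
  case empty
  then show ?case by (auto intro: cong_refl)
next
  case (insert p A)
  define g where "g = Gcd {p - 1 |p. p \<in> A}"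
  have "{q - 1 |q. q \<in> insert p A} = insert (p - 1) {p - 1 |p. p \<in> A}" by auto
  then have "gcd (p - 1) g dvd x" using insert.prems by (simp add: g_def)
  then obtain l where l: "x = gcd (p - 1) g * l" by auto
  obtain u v where uv: "u * int (p - 1) + v * int g = gcd (int (p - 1)) (int g)"
    using bezout_int by blast
  define a b where "a = nat ((u * int l) mod int c)" and "b = nat ((v * int l) mod int c)"
  have ab: "[int a = u * int l] (mod int c)" "[int b = v * int l] (mod int c)"
    using insert.prems by (auto simp: a_def b_def cong_def)
  have "[int a * int (p - 1) + int b * int g = (u * int l) * int (p - 1) + (v * int l) * int g] (mod int c)"
    by (intro cong_add cong_mult ab cong_refl)
  also have "(u * int l) * int (p - 1) + (v * int l) * int g = (u * int (p - 1) + v * int g) * int l"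
    by (simp add: algebra_simps)
  also have "\<dots> = int x" using uv l by (simp only: gcd_int_int_eq of_nat_mult)
  finally have "[int (a * (p - 1) + b * g) = int x] (mod int c)" by simp
  then have ab': "[a * (p - 1) + b * g = x] (mod c)" by (simp only: cong_int_iff)
  have "unit_chain S (s + a * (p - 1))" for a
  proof (induction a)
    case (Suc a)
    from unit_chain_add_prime[OF this, of p] insert.prems show ?case by (simp add: ac_simps)
  qed (use insert.prems in simp)
  then obtain s' where s': "unit_chain S s'" "[s' = s + a * (p - 1) + b * g] (mod c)"
    using insert.IH[of "s + a * (p - 1)" "b * g"] insert.prems by (auto simp: g_def)
  have "[s + (a * (p - 1) + b * g) = s + x] (mod c)" by (intro cong_add cong_refl ab')
  then show ?case using s' by (metis cong_trans add.assoc)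
qed

section \<open>Interleaving basic and extra steps\<close>

text \<open>The length counts \<open>(P - 1) * k + 1\<close> basic steps, \<open>s\<close> extra
  steps and the closing edge. The bound \<open>k \<ge> s\<close> provides enough basic steps to keep
  the extra ones apart.\<close>

lemma nondegenerate_induced_cycle_of_unit_chain:
  assumes S: "finite S" "\<forall>p\<in>S. prime p" and P: "P = \<Prod>S" "P \<ge> 2"
    and k: "k \<ge> P ^ 3 + 2" "k \<ge> s" and chain: "unit_chain S s"
  shows "\<exists>a. induced_cycle (S_unit_graph S) ((P - 1) * k + s + 2) a \<and>
    \<not> degenerate_cycle ((P - 1) * k + s + 2) a"
proof -
  obtain y where y: "\<forall>r<s. smooth S (y r)" "smooth S (1 + (\<Sum>r<s. y r))"
    using chain by (auto simp: unit_chain_def)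
  define M where "M = (P - 1) * k + 1"
  define N where "N = M + s"
  define G where "G q = (\<Sum>r<q. P ^ (r mod k))" for q
  define h where "h i = (\<Sum>r<i. y r)" for i
  \<comment> \<open>The extra steps \<open>P ^ k * y r\<close> take the places \<open>1, 3, \<dots>, 2 * s - 1\<close>, counting from \<open>0\<close>; among
    the first \<open>i\<close> steps there are \<open>\<sigma> i\<close> of them and \<open>\<mu> i\<close> basic ones.\<close>
  define \<sigma> where "\<sigma> i = min (i div 2) s" for i
  define \<mu> where "\<mu> i = i - \<sigma> i" for i
  define F where "F i = G (\<mu> i) + P ^ k * h (\<sigma> i)" for i
  have "k \<le> (P - 1) * k" using P by (cases "P - 1") auto
  then have M: "s < M" "M \<ge> 2" using k unfolding M_def by linarith+
  have smP: "smooth S (P ^ e)" for e using S P smooth_prod[of S S] smooth_power by auto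
  have G_less: "G q < G q'" if "q < q'" for q q'
    unfolding G_def using that P by (intro sum_strict_mono2[where b = q]) auto
  have h_less: "h i < h j" if "i < j" "j \<le> s" for i j
    unfolding h_def using that y by (intro sum_strict_mono2[where b = i]) (auto simp: smooth_def)
  have G_Suc: "G (Suc q) = G q + P ^ (q mod k)" for q by (simp add: G_def)
  have GM: "G M = P ^ k"
  proof -
    have "k > 1" using k by auto
    then have "M div k = P - 1" "M mod k = 1"
      using div_mult_self1[of k 1 "P - 1"] mod_mult_self1[of 1 "P - 1" k]
      by (simp_all add: M_def add.commute)
    then have "int (G M) * (int P - 1) = int P ^ k * (int P - 1)"
      using sum_power_mod[of k P M] \<open>k > 1\<close> P by (simp add: G_def of_nat_diff algebra_simps)
    then have "int (G M) = int (P ^ k)" using P(2) by simp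
    then show ?thesis by (simp only: of_nat_eq_iff)
  qed
  have block: "(\<forall>p\<in>S. \<not> p ^ k dvd G q' - G q) \<and> (smooth S (G q' - G q) \<longrightarrow> q' = q + 1)"
    if "q < q'" "q' \<le> M" "\<not> (q = 0 \<and> q' = M)" for q q'
    using block_of_powers[OF S P k(1), of q q'] that by (simp add: G_def M_def)
  have "F i < F j \<and> (smooth S (F j - F i) \<longleftrightarrow> j = i + 1 \<or> (i = 0 \<and> j = N))"
    if ij: "i < j" "j \<le> N" for i j
  proof -
    have \<sigma>: "\<sigma> i \<le> \<sigma> j" "\<sigma> j \<le> s" using ij by (auto simp: \<sigma>_def div_le_mono min.coboundedI1)
    have \<mu>: "\<mu> i \<le> \<mu> j" "\<mu> j \<le> M" "\<mu> j + \<sigma> j = j" "\<mu> i + \<sigma> i = i"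
      using ij M by (auto simp: \<mu>_def \<sigma>_def N_def min_def)
    \<comment> \<open>The walk starts with a basic step, and while extra steps remain at most
      \<open>s < M\<close> basic ones have occurred. Hence only the whole walk contains all basic
      steps.\<close>
    have \<mu>0: "\<mu> i = 0 \<longleftrightarrow> i = 0" by (auto simp: \<mu>_def \<sigma>_def min_def)
    have \<mu>M: "\<mu> j = M \<longleftrightarrow> j = N"
    proof (cases "j div 2 < s")
      case True
      then have "j < 2 * s" "\<mu> j = j - j div 2" by (auto simp: \<mu>_def \<sigma>_def)
      then have "\<mu> j < M" "j < N" using M(1) unfolding N_def by linarith+
      then show ?thesis by simp
    qed (use ij in \<open>auto simp: \<mu>_def \<sigma>_def N_def\<close>)
    define A where "A = G (\<mu> j) - G (\<mu> i)"
    define Y where "Y = P ^ k * (h (\<sigma> j) - h (\<sigma> i))"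
    have G: "G (\<mu> i) \<le> G (\<mu> j)" using G_less[of "\<mu> i" "\<mu> j"] \<mu> by (cases "\<mu> i = \<mu> j") auto
    have h: "h (\<sigma> i) \<le> h (\<sigma> j)" using h_less[of "\<sigma> i" "\<sigma> j"] \<sigma> by (cases "\<sigma> i = \<sigma> j") auto
    have FA: "F j = F i + (A + Y)"
      using G mult_le_mono2[OF h, of "P ^ k"]
      unfolding F_def A_def Y_def diff_mult_distrib2 by linarith
    have A0: "A > 0 \<longleftrightarrow> \<mu> i < \<mu> j" using G_less[of "\<mu> i" "\<mu> j"] \<mu>(1)
      by (cases "\<mu> i = \<mu> j") (auto simp: A_def)
    have Y0: "Y > 0 \<longleftrightarrow> \<sigma> i < \<sigma> j" using h_less[of "\<sigma> i" "\<sigma> j"] \<sigma> P(2)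
      by (cases "\<sigma> i = \<sigma> j") (auto simp: Y_def)
    \<comment> \<open>\<open>A\<close> collects the basic and \<open>Y\<close> the extra steps
      between \<open>i\<close> and \<open>j\<close>. Apart from the whole walk, a block without
      basic steps is a single extra step, one without extra steps is a proper basic block, and a
      mixed one is never smooth.\<close>
    have "smooth S (A + Y) \<longleftrightarrow> j = i + 1 \<or> (i = 0 \<and> j = N)"
    proof (cases "i = 0 \<and> j = N")
      case True
      have "\<sigma> N = s" "\<mu> N = M" "\<sigma> 0 = 0" "\<mu> 0 = 0" using M by (auto simp: \<sigma>_def \<mu>_def N_def)
      then have "A + Y = P ^ k * (1 + h s)" using True GM by (simp add: A_def Y_def G_def h_def)
      then have "smooth S (A + Y)" using smP y(2) by (simp only: h_def smooth_mult)
      then show ?thesis using True by simp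
    next
      case part: False
      show ?thesis
      proof (cases "\<mu> i = \<mu> j")
        case True
        have j: "j = i + 1" using True ij by (auto simp: \<mu>_def \<sigma>_def min_def split: if_splits)
        then have "\<sigma> j = Suc (\<sigma> i)" using True \<mu> by linarith
        moreover from this have "smooth S (y (\<sigma> i))" using y \<sigma> by auto
        ultimately have "smooth S (A + Y)"
          using True smP by (auto simp: A_def Y_def h_def intro: smooth_mult)
        then show ?thesis using j by simp
      next
        case False
        then have less: "\<mu> i < \<mu> j" using \<mu> by simp
        have b: "(\<forall>p\<in>S. \<not> p ^ k dvd A) \<and> (smooth S A \<longrightarrow> \<mu> j = \<mu> i + 1)"
          unfolding A_def using block[OF less \<mu>(2)] part \<mu>0 \<mu>M by blast
        show ?thesis
        proof (cases "\<sigma> i = \<sigma> j")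
          case True
          have "smooth S A" if "\<mu> j = Suc (\<mu> i)"
            using smP by (simp add: A_def that G_Suc)
          then show ?thesis using True b part \<mu> by (auto simp: Y_def)
        next
          case False
          have "p ^ k dvd Y" if "p \<in> S" for p
            using that S P by (auto simp: Y_def intro!: dvd_mult2 dvd_power_same dvd_prodI)
          then have "\<not> smooth S (A + Y)"
            using not_smooth_add[of S k A Y] b A0 Y0 less \<sigma> False by auto
          moreover have "j \<noteq> i + 1" using False less \<sigma> \<mu> by linarith
          ultimately show ?thesis using part by simp
        qed
      qed
    qed
    moreover have "A + Y > 0" using A0 Y0 \<mu> \<sigma> ij by linarith
    ultimately show ?thesis by (simp add: FA)
  qed
  then have "\<exists>a. induced_cycle (S_unit_graph S) (N + 1) a \<and> \<not> degenerate_cycle (N + 1) a"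
    using induced_nondegenerate_cycle_of_increasing[of N F S] M by (auto simp: N_def)
  then show ?thesis by (simp add: N_def M_def)
qed

section \<open>A threshold uniform in the cycle length\<close>

theorem corollary1p7:
  fixes S :: "nat set" and m :: nat
  assumes "finite S" and "S \<noteq> {}" and "\<forall>p\<in>S. prime p"
    and "m = Gcd {p - 1 | p. p \<in> S}"
  shows "\<exists>N::nat. \<forall>n::nat. n \<ge> N \<and> [n = 2] (mod m) \<longrightarrow>
           (\<exists>a :: nat \<Rightarrow> rat. induced_cycle (S_unit_graph S) n a \<and> \<not> degenerate_cycle n a)"
proof -
  define P where "P = \<Prod>S"
  have "P > 0" unfolding P_def using assms prime_gt_0_nat by (intro prod_pos) auto
  obtain p where p: "p \<in> S" "p \<ge> 2" using assms prime_ge_2_nat by blast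
  then have "p dvd P" using assms by (auto simp: P_def intro: dvd_prodI)
  then have P: "P \<ge> 2" using \<open>P > 0\<close> p by (auto dest: dvd_imp_le)
  define c where "c = P - 1"
  have "c > 0" using P by (simp add: c_def)
  \<comment> \<open>Fixing one chain length per residue modulo \<open>c\<close> makes
    \<open>B\<close> a bound independent of \<open>n\<close>. A residue without a chain gets an
    arbitrary value, which can only enlarge \<open>B\<close>.\<close>
  define f where "f r = (SOME s. unit_chain S s \<and> [s = r] (mod c))" for r
  define B where "B = (\<Sum>r<c. f r)"
  show ?thesis
  \<comment> \<open>After subtracting \<open>2\<close> and \<open>s \<le> B\<close> from
    \<open>n\<close>, at least \<open>c * (P ^ 3 + 2 + B)\<close> remains, so the quotient
    \<open>k\<close> by \<open>c\<close> exceeds both required bounds, \<open>P ^ 3 + 2\<close> and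
    \<open>s\<close>, or equals them.\<close>
  proof (rule exI[of _ "2 + B + c * (P ^ 3 + 2 + B)"], intro allI impI)
    fix n assume "2 + B + c * (P ^ 3 + 2 + B) \<le> n \<and> [n = 2] (mod m)"
    then have n: "2 + B + c * (P ^ 3 + 2 + B) \<le> n" and "[n = 2] (mod m)" by auto
    then have "m dvd n - 2" by (simp add: cong_altdef_nat)
    then obtain s' where s': "unit_chain S s'" "[s' = n - 2] (mod c)"
      using unit_chain_cong[of S S c 0 "n - 2"] unit_chain_0 assms \<open>c > 0\<close> by auto
    define r where "r = (n - 2) mod c"
    define s where "s = f r"
    have "\<exists>s. unit_chain S s \<and> [s = r] (mod c)" using s' by (auto simp: r_def cong_def)
    from someI_ex[OF this] have s: "unit_chain S s" "[s = r] (mod c)"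
      by (auto simp: s_def f_def)
    have "s \<le> B" unfolding s_def B_def
      using \<open>c > 0\<close> by (intro member_le_sum) (auto simp: r_def)
    then have "s \<le> n - 2" "c * (P ^ 3 + 2 + B) \<le> n - 2 - s" using n by auto
    have "[n - 2 = s] (mod c)" using s(2) by (simp add: r_def cong_def)
    then have "c dvd n - 2 - s" using \<open>s \<le> n - 2\<close> by (simp add: cong_altdef_nat)
    then obtain k where k: "n - 2 - s = c * k" by auto
    then have "P ^ 3 + 2 + B \<le> k"
      using \<open>c * (P ^ 3 + 2 + B) \<le> n - 2 - s\<close> \<open>c > 0\<close> unfolding k mult_le_cancel1 by blast
    moreover have "n = (P - 1) * k + s + 2" using k \<open>s \<le> n - 2\<close> n by (simp add: c_def)
    ultimately show "\<exists>a. induced_cycle (S_unit_graph S) n a \<and> \<not> degenerate_cycle n a"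
      using nondegenerate_induced_cycle_of_unit_chain[of S P k s] assms P s(1) \<open>s \<le> B\<close>
      by (simp add: P_def)
  qed
qed

end
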